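(* Fix $L>0$. There exists $C>0$ such that the following holds. Let $u^0\in H^6(0,L)$ satisfy $u^0\in \mathrm{Dom}(P)$, $Pu^0\in\mathrm{Dom}(P)$ and $P^2u^0\in\mathrm{Dom}(P)$, and let $u$ be the solution of $\partial_t u=Pu$, $u(0)=u^0$, i.e. $u(t,x)=\sum_{p\ge 0}\alpha_p e^{-p^2\pi^2 t/L^2}c_p(x)$ with $\alpha_p=\langle u^0,c_p\rangle$. Let $J\ge 2$ and $\delta t\in(0,1)$ satisfy $\delta t/\delta x^2\le 1/2$, let $\mathsf v^0\in\mathbb R^J$ be arbitrary and $\mathsf v^{n+1}=(\mathrm{Id}+\delta t\,\mathsf P_\delta)\mathsf v^n$ for $n\ge0$. Then for all $n\ge 1$, $$\|\Pi_{\delta x}u(n\delta t)-\mathsf v^n\|_{\ell^2}\le \|\Pi_{\delta x}u^0-\mathsf v^0\|_{\ell^2}+C\Big(\delta x\sum_{p=1}^{\infty}|\alpha_p|p^4+\delta t\,\|P^2u^0\|_{H^1}\Big).$$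
   Context: $P=\partial_x^2$ on $(0,L)$ with homogeneous Neumann boundary conditions; $\mathrm{Dom}(P)=\{u\in L^2(0,L):\partial_x^2u\in L^2(0,L),\ \partial_xu(0)=\partial_xu(L)=0\}$. On $L^2(0,L)$ use the inner product $\langle u,v\rangle=\frac1L\int_0^Luv\,dx$, and set $c_0=1$, $c_p(x)=\sqrt2\cos(p\pi x/L)$ for $p\ge1$ (an orthonormal basis). For $J\ge2$: $\delta x=L/(J-1)$, $x_j=j\delta x$ for $0\le j\le J-1$; $\mathbb R^J$ carries the inner product $\langle \mathsf v,\mathsf w\rangle_\delta=\frac1J\sum_{j=0}^{J-1}\mathsf v_j\mathsf w_j$ with norm $\|\cdot\|_{\ell^2}$. $\Pi_{\delta x}w=(w(x_0),\dots,w(x_{J-1}))^\top$ for continuous $w$ on $[0,L]$. $\mathsf P_\delta$ is the $J\times J$ symmetric tridiagonal matrix $\frac1{\delta x^2}$ times the matrix with diagonal $(-1,-2,\dots,-2,-1)$ and all sub/super-diagonal entries equal to $1$. $H^1,H^s$ denote the standard Sobolev norms on $(0,L)$. *)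

theory Defs
  imports "HOL-Analysis.Analysis"
begin

(* Sobolev H^k(0,L) via a family of successive (weak) derivatives:
   g 0 = u, g (j+1) = derivative of g j in the absolutely continuous sense,
   g k in L^2(0,L). For j < k the g j are the continuous representatives. *)
definition sobolev_family :: "real \<Rightarrow> nat \<Rightarrow> (nat \<Rightarrow> real \<Rightarrow> real) \<Rightarrow> bool" where
  "sobolev_family L k g \<longleftrightarrow>
     (\<forall>j\<le>k. g j integrable_on {0..L}) \<and>
     (\<lambda>x. (g k x)\<^sup>2) integrable_on {0..L} \<and>
     (\<forall>j<k. \<forall>x\<in>{0..L}. g j x = g j 0 + integral {0..x} (g (Suc j)))"

definition H1_norm :: "real \<Rightarrow> (real \<Rightarrow> real) \<Rightarrow> (real \<Rightarrow> real) \<Rightarrow> real" where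
  "H1_norm L f f' = sqrt (integral {0..L} (\<lambda>x. (f x)\<^sup>2) + integral {0..L} (\<lambda>x. (f' x)\<^sup>2))"

definition cbasis :: "real \<Rightarrow> nat \<Rightarrow> real \<Rightarrow> real" where
  "cbasis L p x = (if p = 0 then 1 else sqrt 2 * cos (real p * pi * x / L))"

definition coeff :: "real \<Rightarrow> (real \<Rightarrow> real) \<Rightarrow> nat \<Rightarrow> real" where
  "coeff L u0 p = (1 / L) * integral {0..L} (\<lambda>x. u0 x * cbasis L p x)"

definition heat_sol :: "real \<Rightarrow> (real \<Rightarrow> real) \<Rightarrow> real \<Rightarrow> real \<Rightarrow> real" where
  "heat_sol L u0 t x =
     (\<Sum>p. coeff L u0 p * exp (- ((real p)\<^sup>2 * pi\<^sup>2 * t / L\<^sup>2)) * cbasis L p x)"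

definition grid_dx :: "real \<Rightarrow> nat \<Rightarrow> real" where
  "grid_dx L J = L / (real J - 1)"

(* Pi_dx w = (w(x_0),...,w(x_{J-1})), x_j = j dx; vectors are nat => real, entries j < J *)
definition grid_proj :: "real \<Rightarrow> nat \<Rightarrow> (real \<Rightarrow> real) \<Rightarrow> nat \<Rightarrow> real" where
  "grid_proj L J w j = w (real j * grid_dx L J)"

definition l2_norm :: "nat \<Rightarrow> (nat \<Rightarrow> real) \<Rightarrow> real" where
  "l2_norm J v = sqrt ((1 / real J) * (\<Sum>j<J. (v j)\<^sup>2))"

definition Pdelta :: "real \<Rightarrow> nat \<Rightarrow> nat \<Rightarrow> nat \<Rightarrow> real" where
  "Pdelta L J i k =
     (if i = k then (if i = 0 \<or> i = J - 1 then -1 else -2)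
      else if i + 1 = k \<or> k + 1 = i then 1 else 0) / (grid_dx L J)\<^sup>2"

end

theory Submission
  imports Defs
begin

text \<open>One explicit Euler step is a symmetric doubly stochastic average, hence an \<open>\<ell>\<^sup>2\<close> contraction,
  and it is diagonalised by cosines sampled at cell midpoints, which lie within \<open>\<delta>x / 2\<close> of the
  grid points. So each Fourier mode
  of the exact solution is followed up to a first-order error, provided the powers \<open>a\<^sup>n\<close>, \<open>b\<^sup>n\<close> of the
  continuous and discrete multipliers are close uniformly in \<open>n\<close>: for resolved modes
  \<open>\<bar>a\<^sup>n - b\<^sup>n\<bar> \<le> \<bar>a - b\<bar> / (1 - max a b)\<close>, where the decay of the modes absorbs the
  number of steps, and for modes with \<open>p > J / 3\<close> the trivial bound 2 is already of order
  \<open>p \<delta>x\<close>. The stability condition gives \<open>\<delta>t \<le> \<delta>x\<^sup>2 / 2\<close>, so the time-discretisation error is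
  absorbed in the \<open>\<delta>x\<close> term. Summing over the modes needs
  the absolute convergence of the series (integration by parts and Bessel's inequality) and the
  pointwise cosine expansion of the initial datum (Stone-Weierstrass in the variable
  \<open>cos (\<pi> x / L)\<close>).\<close>

section \<open>The discrete heat semigroup\<close>

text \<open>An explicit Euler step with \<open>r\<close> = dt/dx^2, written as exchange with the
  existing neighbours: an end point lacks one exchange term, which is how the matrix encodes the
  Neumann condition.\<close>

definition neumann_step :: "real \<Rightarrow> nat \<Rightarrow> (nat \<Rightarrow> real) \<Rightarrow> nat \<Rightarrow> real" where
  "neumann_step r J w i = w i + r * ((if 0 < i then w (i - 1) - w i else 0) +
                                     (if Suc i < J then w (Suc i) - w i else 0))"

lemma Pdelta_sum:
  assumes "J \<ge> 2" "i < J"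
  shows "(\<Sum>k<J. Pdelta L J i k * w k) =
    ((if 0 < i then w (i - 1) - w i else 0) + (if Suc i < J then w (Suc i) - w i else 0)) / (grid_dx L J)\<^sup>2"
proof -
  \<comment> \<open>The row splits into three indicator terms. Since \<open>i - 1\<close> is 0 at
    \<open>i = 0\<close>, the guard \<open>0 < i\<close> keeps the lower neighbour from duplicating
    the diagonal entry.\<close>
  have eq: "Pdelta L J i k * w k = ((if k = i then (if i = 0 \<or> i = J - 1 then -1 else -2) * w k else 0) +
      (if k = Suc i then w k else 0) + (if k = i - 1 then if 0 < i then w k else 0 else 0)) / (grid_dx L J)\<^sup>2" for k
    using assms by (auto simp: Pdelta_def)
  show ?thesis
    unfolding eq sum_divide_distrib[symmetric] sum.distrib sum.delta[OF finite_lessThan]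
    using assms by auto
qed

text \<open>Vectors are functions on all naturals, but a step at an index below \<open>J\<close>
  reads only entries below \<open>J\<close>; arbitrary values beyond are harmless.\<close>

lemma neumann_step_cong:
  assumes "\<And>k. k < J \<Longrightarrow> w k = w' k" "i < J"
  shows "neumann_step r J w i = neumann_step r J w' i"
  using assms by (auto simp: neumann_step_def)

lemma neumann_step_diff:
  "neumann_step r J (\<lambda>k. w k - w' k) i = neumann_step r J w i - neumann_step r J w' i"
  by (auto simp: neumann_step_def algebra_simps)

lemma neumann_step_scale:
  "neumann_step r J (\<lambda>k. c * w k) i = c * neumann_step r J w i"
  by (auto simp: neumann_step_def algebra_simps)

lemma neumann_step_sums:
  assumes "\<And>k. k < J \<Longrightarrow> (\<lambda>p. w p k) sums s k" "i < J"
  shows "(\<lambda>p. neumann_step r J (w p) i) sums neumann_step r J s i"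
proof -
  have "(\<lambda>p. if 0 < i then w p (i - 1) - w p i else 0) sums (if 0 < i then s (i - 1) - s i else 0)"
    "(\<lambda>p. if Suc i < J then w p (Suc i) - w p i else 0) sums (if Suc i < J then s (Suc i) - s i else 0)"
    using assms(2) by (auto intro!: sums_diff assms(1))
  then show ?thesis
    unfolding neumann_step_def by (intro sums_add sums_mult assms)
qed

text \<open>Jensen's inequality for the square with weights \<open>1 - s - t\<close>,
  \<open>s\<close>, \<open>t\<close>: the gap is the variance, a sum of pairwise weight products
  times squared differences.\<close>

lemma square_convex_comb3:
  fixes x y z s t :: real
  assumes "s \<ge> 0" "t \<ge> 0" "s + t \<le> 1"
  shows "(x + (s * (y - x) + t * (z - x)))\<^sup>2 \<le> x\<^sup>2 + (s * (y\<^sup>2 - x\<^sup>2) + t * (z\<^sup>2 - x\<^sup>2))"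
proof -
  have "0 \<le> s * (1 - s - t) * (y - x)\<^sup>2 + t * (1 - s - t) * (z - x)\<^sup>2 + s * t * (y - z)\<^sup>2"
    using assms by (intro add_nonneg_nonneg mult_nonneg_nonneg) auto
  also have "\<dots> = x\<^sup>2 + (s * (y\<^sup>2 - x\<^sup>2) + t * (z\<^sup>2 - x\<^sup>2)) - (x + (s * (y - x) + t * (z - x)))\<^sup>2"
    by (simp add: power2_eq_square algebra_simps)
  finally show ?thesis by simp
qed

text \<open>Jensen applies because \<open>r \<le> 1/2\<close> keeps the central weight nonnegative,
  which is \<open>1 - 2 * r\<close> in the interior.\<close>

lemma neumann_step_square_le:
  assumes "0 \<le> r" "r \<le> 1/2"
  shows "(neumann_step r J w i)\<^sup>2 \<le> neumann_step r J (\<lambda>k. (w k)\<^sup>2) i"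
  using square_convex_comb3[of "if 0 < i then r else 0" "if Suc i < J then r else 0" "w i" "w (i - 1)" "w (Suc i)"]
    assms unfolding neumann_step_def distrib_left by (auto split: if_splits)

lemma sum_neumann_step: "(\<Sum>i<J. neumann_step r J w i) = (\<Sum>i<J. w i)"
proof (cases J)
  case (Suc m)
  \<comment> \<open>Each exchange between neighbours occurs twice with opposite signs, once from
    either side; shifting the index by one matches the two.\<close>
  define F where "F i = (if 0 < i then w i - w (i - 1) else 0)" for i
  have "(\<Sum>i<J. F i) = (\<Sum>i<J. if Suc i < J then w (Suc i) - w i else 0)"
    unfolding Suc by (subst sum.lessThan_Suc_shift) (simp add: F_def)
  moreover have "neumann_step r J w i = w i + r * ((if Suc i < J then w (Suc i) - w i else 0) - F i)" for i
    by (auto simp: neumann_step_def F_def)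
  ultimately show ?thesis
    by (simp add: sum.distrib sum_distrib_left[symmetric] sum_subtractf)
qed simp

section \<open>The mean-square norm of grid vectors\<close>

lemma l2_norm_L2_set: "l2_norm J w = L2_set w {..<J} / sqrt (real J)"
  by (simp add: l2_norm_def L2_set_def real_sqrt_mult real_sqrt_divide)

lemma l2_norm_cong: "(\<And>i. i < J \<Longrightarrow> w i = w' i) \<Longrightarrow> l2_norm J w = l2_norm J w'"
  by (simp add: l2_norm_def)

lemma l2_norm_nonneg: "0 \<le> l2_norm J w"
  by (simp add: l2_norm_def sum_nonneg)

lemma l2_norm_triangle: "l2_norm J (\<lambda>i. w i + w' i) \<le> l2_norm J w + l2_norm J w'"
  unfolding l2_norm_L2_set add_divide_distrib[symmetric]
  by (intro divide_right_mono L2_set_triangle_ineq) simp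

lemma l2_norm_scale: "l2_norm J (\<lambda>i. c * w i) = \<bar>c\<bar> * l2_norm J w"
  by (simp add: l2_norm_def power_mult_distrib sum_distrib_left[symmetric] real_sqrt_mult real_sqrt_divide)

lemma l2_norm_sum: "l2_norm J (\<lambda>i. \<Sum>p<(N::nat). w p i) \<le> (\<Sum>p<N. l2_norm J (w p))"
proof (induction N)
  case (Suc N)
  then show ?case using l2_norm_triangle[of J "\<lambda>i. \<Sum>p<N. w p i" "w N"] by simp
qed (simp add: l2_norm_def)

lemma l2_norm_le:
  assumes "\<And>i. i < J \<Longrightarrow> \<bar>w i\<bar> \<le> B" "B \<ge> 0"
  shows "l2_norm J w \<le> B"
proof -
  have "(\<Sum>i<J. (w i)\<^sup>2) \<le> (\<Sum>i<J. B\<^sup>2)"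
    using assms by (intro sum_mono) (metis abs_le_square_iff abs_of_nonneg lessThan_iff)
  then have "(1 / real J) * (\<Sum>i<J. (w i)\<^sup>2) \<le> B\<^sup>2"
    by (cases "J = 0") (auto simp: field_simps)
  then show ?thesis
    unfolding l2_norm_def using assms(2) by (metis real_le_lsqrt)
qed

text \<open>The finite triangle inequality passes to the limit: on a finite grid, entrywise
  convergence already makes the norms converge.\<close>

lemma l2_norm_suminf_le:
  assumes w: "\<And>i. i < J \<Longrightarrow> (\<lambda>p. w p i) sums s i"
    and b: "\<And>p. l2_norm J (w p) \<le> b p" "summable b"
  shows "l2_norm J s \<le> suminf b"
proof (rule LIMSEQ_le_const2)
  show "(\<lambda>N. l2_norm J (\<lambda>i. \<Sum>p<N. w p i)) \<longlonglongrightarrow> l2_norm J s"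
    unfolding l2_norm_def using w by (intro tendsto_intros) (auto simp: sums_def)
  have "l2_norm J (\<lambda>i. \<Sum>p<N. w p i) \<le> suminf b" for N
  proof -
    have "l2_norm J (\<lambda>i. \<Sum>p<N. w p i) \<le> (\<Sum>p<N. l2_norm J (w p))" by (rule l2_norm_sum)
    also have "\<dots> \<le> (\<Sum>p<N. b p)" by (intro sum_mono b)
    also have "\<dots> \<le> suminf b" using b l2_norm_nonneg order_trans by (intro sum_le_suminf) blast+
    finally show ?thesis .
  qed
  then show "\<exists>N. \<forall>n\<ge>N. l2_norm J (\<lambda>i. \<Sum>p<n. w p i) \<le> suminf b" by blast
qed

text \<open>Jensen bounds the squared entries by a step applied to the squares, and a step preserves
  sums.\<close>

lemma l2_norm_neumann_step:
  assumes "0 \<le> r" "r \<le> 1/2"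
  shows "l2_norm J (neumann_step r J w) \<le> l2_norm J w"
proof -
  have "(\<Sum>i<J. (neumann_step r J w i)\<^sup>2) \<le> (\<Sum>i<J. neumann_step r J (\<lambda>k. (w k)\<^sup>2) i)"
    by (intro sum_mono neumann_step_square_le assms)
  then show ?thesis
    unfolding l2_norm_def sum_neumann_step by (intro real_sqrt_le_mono mult_left_mono) auto
qed

section \<open>Iterated steps and the scheme\<close>

abbreviation neumann_iter :: "real \<Rightarrow> nat \<Rightarrow> nat \<Rightarrow> (nat \<Rightarrow> real) \<Rightarrow> nat \<Rightarrow> real" where
  "neumann_iter r J n \<equiv> (neumann_step r J ^^ n)"

lemma l2_norm_neumann_iter:
  assumes "0 \<le> r" "r \<le> 1/2"
  shows "l2_norm J (neumann_iter r J n w) \<le> l2_norm J w"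
  by (induction n) (auto intro: order_trans[OF l2_norm_neumann_step[OF assms]])

lemma neumann_iter_diff:
  "neumann_iter r J n (\<lambda>k. w k - w' k) = (\<lambda>i. neumann_iter r J n w i - neumann_iter r J n w' i)"
  by (induction n) (auto simp: neumann_step_diff)

lemma neumann_iter_scale: "neumann_iter r J n (\<lambda>k. c * w k) = (\<lambda>i. c * neumann_iter r J n w i)"
  by (induction n) (auto simp: neumann_step_scale)

lemma neumann_iter_cong:
  assumes "\<And>k. k < J \<Longrightarrow> w k = w' k" "i < J"
  shows "neumann_iter r J n w i = neumann_iter r J n w' i"
  using assms(2)
proof (induction n arbitrary: i)
  case (Suc n)
  then show ?case by (auto intro: neumann_step_cong)
qed (use assms in auto)

lemma neumann_iter_sums:
  assumes "\<And>k. k < J \<Longrightarrow> (\<lambda>p. w p k) sums s k" "i < J"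
  shows "(\<lambda>p. neumann_iter r J n (w p) i) sums neumann_iter r J n s i"
  using assms(2) by (induction n arbitrary: i) (auto intro: neumann_step_sums assms(1))

lemma scheme_eq_neumann_iter:
  assumes "J \<ge> 2"
    and v: "\<And>m i. i < J \<Longrightarrow> v (Suc m) i = v m i + dt * (\<Sum>k<J. Pdelta L J i k * v m k)"
    and "i < J"
  shows "v n i = neumann_iter (dt / (grid_dx L J)\<^sup>2) J n (v 0) i"
  using \<open>i < J\<close>
proof (induction n arbitrary: i)
  case (Suc n)
  have "v (Suc n) i = neumann_step (dt / (grid_dx L J)\<^sup>2) J (v n) i"
    using Suc.prems assms by (simp add: v Pdelta_sum neumann_step_def)
  also have "\<dots> = neumann_step (dt / (grid_dx L J)\<^sup>2) J (neumann_iter (dt / (grid_dx L J)\<^sup>2) J n (v 0)) i"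
    using Suc by (intro neumann_step_cong)
  finally show ?case by simp
qed simp

text \<open>The eigenvectors are cosines sampled at the midpoints \<^term>\<open>(j + 1/2) * L / J\<close> of a uniform
  partition into \<^term>\<open>J\<close> cells: these are invariant under the reflections that the first and last
  rows of the matrix encode.\<close>

lemma neumann_step_cos:
  assumes "i < J"
  shows "neumann_step r J (\<lambda>j. cos (real p * pi * (real j + 1/2) / real J)) i =
    (1 - 4 * r * (sin (real p * pi / (2 * real J)))\<^sup>2) * cos (real p * pi * (real i + 1/2) / real J)"
proof -
  define h where "h = real p * pi / (2 * real J)"
  define c where "c x = cos (real p * pi * (x + 1/2) / real J)" for x
  have J: "real J > 0" using assms by simp
  have arg: "real p * pi * (x + 1/2) / real J = (2 * x + 1) * h" for x
    using J by (simp add: h_def field_simps)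
  have cx: "c x = cos ((2 * x + 1) * h)" for x unfolding c_def arg ..
  \<comment> \<open>Second difference of a cosine by the addition formulas; the factor comes from
    \<open>1 - cos (2 * h) = 2 * (sin h)\<^sup>2\<close>.\<close>
  have three: "c (x - 1) - c x + (c (x + 1) - c x) = - 4 * (sin h)\<^sup>2 * c x" for x
  proof -
    have "c (x - 1) = cos ((2 * x + 1) * h - 2 * h)" "c (x + 1) = cos ((2 * x + 1) * h + 2 * h)"
      unfolding cx by (auto intro: arg_cong[where f = cos] simp: algebra_simps)
    then have "c (x - 1) + c (x + 1) = 2 * c x * cos (2 * h)"
      unfolding cx by (simp add: cos_add cos_diff)
    then show ?thesis unfolding cos_double_sin by (simp add: algebra_simps)
  qed
  \<comment> \<open>At both ends the ghost value just outside the grid equals the end value, so the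
    missing exchange term can be added back as zero.\<close>
  have left: "c (- 1) = c 0"
    unfolding cx by simp
  have right: "c (real J) = c (real J - 1)"
  proof -
    have "2 * real J * h = real p * pi" using J by (simp add: h_def)
    then have "(2 * real J + 1) * h = real p * pi + h" "(2 * (real J - 1) + 1) * h = real p * pi - h"
      by (auto simp: algebra_simps)
    then show ?thesis unfolding cx by (simp only: cos_add cos_diff) simp
  qed
  have l: "(if 0 < i then c (real (i - 1)) - c (real i) else 0) = c (real i - 1) - c (real i)"
    using left by (cases i) auto
  have "(if Suc i < J then c (real (Suc i)) - c (real i) else 0) = c (real i + 1) - c (real i)"
  proof (cases "Suc i < J")
    case False
    then have "real i = real J - 1" using assms by auto
    then show ?thesis using right False by simp
  qed (simp add: add.commute)
  then have "neumann_step r J (\<lambda>j. c (real j)) i = c (real i) + r * (- 4 * (sin h)\<^sup>2 * c (real i))"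
    unfolding neumann_step_def l three[symmetric] by simp
  then have "neumann_step r J (\<lambda>j. c (real j)) i = (1 - 4 * r * (sin h)\<^sup>2) * c (real i)"
    by (simp add: algebra_simps)
  then show ?thesis unfolding c_def h_def .
qed

text \<open>Factor out \<open>a - b\<close>; the remaining sum is dominated by the geometric series
  in \<open>r\<close>, so the bound does not grow with \<open>n\<close>.\<close>

lemma power_diff_le:
  fixes a b r :: real
  assumes "0 \<le> a" "a \<le> r" "0 \<le> b" "b \<le> r" "r < 1"
  shows "\<bar>a ^ n - b ^ n\<bar> \<le> \<bar>a - b\<bar> / (1 - r)"
proof (cases n)
  case (Suc m)
  have "\<bar>\<Sum>i<Suc m. a ^ i * b ^ (m - i)\<bar> \<le> (\<Sum>i<Suc m. r ^ i)"
  proof -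
    have "a ^ i * b ^ (m - i) \<le> r ^ i * 1" for i
      using assms by (intro mult_mono power_mono power_le_one) auto
    then have "(\<Sum>i<Suc m. a ^ i * b ^ (m - i)) \<le> (\<Sum>i<Suc m. r ^ i)" 
      by (intro sum_mono) auto
    moreover have "(\<Sum>i<Suc m. a ^ i * b ^ (m - i)) \<ge> 0"
      using assms by (intro sum_nonneg) auto
    ultimately show ?thesis by simp
  qed
  also have "\<dots> \<le> 1 / (1 - r)"
    using assms by (subst sum_gp_strict) (auto intro!: divide_right_mono)
  finally have "\<bar>a - b\<bar> * \<bar>\<Sum>i<Suc m. a ^ i * b ^ (m - i)\<bar> \<le> \<bar>a - b\<bar> * (1 / (1 - r))"
    by (intro mult_left_mono) auto
  moreover have "a ^ n - b ^ n = (a - b) * (\<Sum>i<Suc m. a ^ i * b ^ (m - i))"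
    unfolding Suc by (rule diff_power_eq_sum)
  ultimately show ?thesis by (simp add: abs_mult)
qed (use assms in auto)

section \<open>Error of a single mode\<close>

text \<open>The range up to 2/3 is that of the resolved modes. The lower bound yields discrete
  decay, the last bound the spatial consistency error.\<close>

lemma sin_sq_bounds:
  fixes \<theta> :: real
  assumes "0 \<le> \<theta>" "\<theta> \<le> 2/3"
  shows "\<theta>\<^sup>2 / 4 \<le> (sin \<theta>)\<^sup>2" "(sin \<theta>)\<^sup>2 \<le> \<theta>\<^sup>2" "\<theta>\<^sup>2 - (sin \<theta>)\<^sup>2 \<le> \<theta> ^ 4 / 3"
proof -
  \<comment> \<open>The quadratic Taylor coefficient of sine vanishes, so three terms amount to
    \<open>\<theta>\<close> and leave a cubic remainder.\<close>
  have "\<theta> - sin \<theta> \<le> \<bar>sin \<theta> - (\<Sum>m<3. sin_coeff m * \<theta> ^ m)\<bar>"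
    by (simp add: numeral_3_eq_3 sin_coeff_def)
  also have "\<dots> \<le> inverse (fact 3) * \<bar>\<theta>\<bar> ^ 3"
    by (rule Maclaurin_sin_bound)
  also have "\<dots> = \<theta> ^ 3 / 6" using assms by (simp add: fact_numeral)
  finally have lo: "\<theta> - \<theta> ^ 3 / 6 \<le> sin \<theta>" by linarith
  have hi: "sin \<theta> \<le> \<theta>" by (rule sin_x_le_x) fact
  have "\<theta> * \<theta>\<^sup>2 \<le> \<theta> * 1" 
    using assms by (intro mult_left_mono power_le_one) auto
  then have half: "\<theta> / 2 \<le> sin \<theta>" using lo assms by (simp add: power3_eq_cube power2_eq_square)
  have "(\<theta> / 2)\<^sup>2 \<le> (sin \<theta>)\<^sup>2" using half assms by (intro power_mono) auto
  then show "\<theta>\<^sup>2 / 4 \<le> (sin \<theta>)\<^sup>2" by (simp add: power_divide)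
  show "(sin \<theta>)\<^sup>2 \<le> \<theta>\<^sup>2" using hi half assms by (intro power_mono) auto
  have "(\<theta> - sin \<theta>) * (\<theta> + sin \<theta>) \<le> (\<theta> ^ 3 / 6) * (2 * \<theta>)"
    using lo hi half assms by (intro mult_mono) auto
  then show "\<theta>\<^sup>2 - (sin \<theta>)\<^sup>2 \<le> \<theta> ^ 4 / 3"
    by (simp add: eval_nat_numeral algebra_simps)
qed

text \<open>The first bound is the consistency error of one Euler step; the second quantifies the
  decay of the exact multiplier.\<close>

lemma exp_minus_bounds:
  fixes y :: real
  assumes "0 \<le> y"
  shows "\<bar>exp (- y) - (1 - y)\<bar> \<le> y\<^sup>2 / 2" "y / (1 + y) \<le> 1 - exp (- y)"
proof -
  have "1 - y \<le> exp (- y)" using exp_ge_add_one_self[of "- y"] by simp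
  moreover have "exp (- y) \<le> 1 - y + y\<^sup>2 / 2"
  proof -
    \<comment> \<open>The product of the two quadratic Taylor polynomials is at least 1, which turns
      a lower bound on \<open>exp y\<close> into an upper bound on \<open>exp (- y)\<close>.\<close>
    have "1 \<le> 1 + y ^ 4 / 4" using assms by simp
    also have "\<dots> = (1 - y + y\<^sup>2 / 2) * (1 + y + y\<^sup>2 / 2)"
      by (simp add: eval_nat_numeral algebra_simps)
    also have "\<dots> \<le> (1 - y + y\<^sup>2 / 2) * exp y"
      using assms zero_le_power2[of "y - 1"]
      by (intro mult_left_mono exp_lower_Taylor_quadratic) (auto simp: power2_eq_square algebra_simps)
    finally show ?thesis by (simp add: exp_minus field_simps)
  qed
  ultimately show "\<bar>exp (- y) - (1 - y)\<bar> \<le> y\<^sup>2 / 2" by simp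
  have "1 + y \<le> exp y" by (rule exp_ge_add_one_self)
  then have "exp (- y) \<le> 1 / (1 + y)" using assms by (simp add: exp_minus field_simps)
  then show "y / (1 + y) \<le> 1 - exp (- y)" using assms by (simp add: field_simps)
qed

text \<open>Here \<open>x\<close> stands for p pi/L, \<open>h\<close> for dx and \<open>s\<close>
  for (J-1)/J, the ratio of the cell width L/J to dx. Both one-step multipliers are at most
  \<open>1 - y / 16\<close>, and they differ by at most \<open>y\<close> times the final bracket, so
  \<open>y\<close> cancels in \<open>power_diff_le\<close>.\<close>

lemma multiplier_error_resolved:
  fixes x h s dt \<theta> L :: real
  assumes pos: "0 < x" "0 < h" "0 < dt" and dt: "dt / h\<^sup>2 \<le> 1/2"
    and s: "1/2 \<le> s" "s \<le> 1" and \<theta>: "2 * \<theta> = x * h * s" "\<theta> \<le> 2/3"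
  shows "\<bar>exp (- (x\<^sup>2 * dt)) ^ n - (1 - 4 * (dt / h\<^sup>2) * (sin \<theta>)\<^sup>2) ^ n\<bar> \<le> 16 * (x\<^sup>2 * h\<^sup>2 / 3 + 2 * (1 - s))"
proof -
  define y where "y = x\<^sup>2 * dt"
  define z where "z = 4 * (dt / h\<^sup>2) * (sin \<theta>)\<^sup>2"
  have \<theta>0: "0 \<le> \<theta>"
  proof -
    have "0 \<le> x * h * s" using pos s by simp
    with \<theta> show ?thesis by linarith
  qed
  note sb = sin_sq_bounds[OF \<theta>0 \<theta>(2)]
  have y0: "0 < y" using pos by (simp add: y_def)
  have q: "4 * \<theta>\<^sup>2 = x\<^sup>2 * h\<^sup>2 * s\<^sup>2"
    using arg_cong[OF \<theta>(1), of "\<lambda>u. u\<^sup>2"] by (simp add: power_mult_distrib)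
  have s2: "1/4 \<le> s\<^sup>2" "s\<^sup>2 \<le> 1" "1 - s\<^sup>2 \<le> 2 * (1 - s)"
    using power_mono[OF s(1), of 2] power_le_one[of s 2] s zero_le_power2[of "1 - s"]
    by (auto simp: power2_eq_square algebra_simps)
  have \<theta>2: "\<theta>\<^sup>2 \<le> 4/9" using power_mono[OF \<theta>(2) \<theta>0, of 2] by (simp add: power2_eq_square)
  have dt': "dt \<le> h\<^sup>2 / 2" using dt pos by (simp add: field_simps)
  \<comment> \<open>Keeps the discrete multiplier \<open>1 - z\<close> nonnegative, as
    \<open>power_diff_le\<close> requires.\<close>
  have z: "z \<le> 8/9"
  proof -
    have "4 * (dt / h\<^sup>2) * (sin \<theta>)\<^sup>2 \<le> 4 * (1/2) * (4/9)"
      using dt pos sb \<theta>2 by (intro mult_mono) auto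
    then show ?thesis by (simp add: z_def)
  qed
  \<comment> \<open>The factor 16 collects 1/4 from \<open>s\<^sup>2\<close> and 1/4 from the lower
    bound on the squared sine.\<close>
  have zlow: "y / 16 \<le> z"
  proof -
    have "dt / h\<^sup>2 * (x\<^sup>2 * h\<^sup>2 * (1/4)) \<le> dt / h\<^sup>2 * (x\<^sup>2 * h\<^sup>2 * s\<^sup>2)"
      using pos s2 by (intro mult_left_mono) auto
    then have "dt * x\<^sup>2 / 4 \<le> dt / h\<^sup>2 * (4 * \<theta>\<^sup>2)"
      unfolding q using pos by simp
    also have "\<dots> \<le> dt / h\<^sup>2 * (16 * (sin \<theta>)\<^sup>2)"
      using pos sb by (intro mult_left_mono) auto
    finally show ?thesis by (simp add: y_def z_def mult_ac)
  qed
  \<comment> \<open>Ensures \<open>1 + y \<le> 16\<close>, so the exact multiplier has the same gap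
    \<open>y / 16\<close>.\<close>
  have y4: "y \<le> 4"
  proof -
    have "y \<le> x\<^sup>2 * (h\<^sup>2 / 2)" unfolding y_def using dt' by (intro mult_left_mono) auto
    moreover have "x\<^sup>2 * h\<^sup>2 * (1/4) \<le> x\<^sup>2 * h\<^sup>2 * s\<^sup>2" using s2 by (intro mult_left_mono) auto
    ultimately show ?thesis using q \<theta>2 by simp
  qed
  have "y / 16 \<le> y / (1 + y)" using y0 y4 by (intro divide_left_mono) auto
  then have a: "exp (- y) \<le> 1 - y / 16" using exp_minus_bounds(2)[of y] y0 by linarith
  have "\<bar>exp (- y) ^ n - (1 - z) ^ n\<bar> \<le> \<bar>exp (- y) - (1 - z)\<bar> / (1 - (1 - y / 16))"
    using a z zlow y0 by (intro power_diff_le) auto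
  also have "\<dots> \<le> y * (x\<^sup>2 * h\<^sup>2 / 3 + 2 * (1 - s)) / (y / 16)"
  proof -
    \<comment> \<open>\<open>S\<close> is the frequency mismatch between grid points and cell
      midpoints, \<open>T\<close> the replacement of the angle by its sine. \<open>A\<close> bounds
      the Taylor remainder of the exponential, with dt traded for
      \<open>h\<^sup>2 / 2\<close>.\<close>
    define S T where "S = y * (1 - s\<^sup>2)" and "T = 4 * (dt / h\<^sup>2) * (\<theta>\<^sup>2 - (sin \<theta>)\<^sup>2)"
    define A B C where "A = y * (x\<^sup>2 * h\<^sup>2 / 4)" and "B = y * (x\<^sup>2 * h\<^sup>2 / 12)" and "C = y * (2 * (1 - s))"
    have "y\<^sup>2 / 2 \<le> A"
    proof -
      have "x\<^sup>2 * dt \<le> x\<^sup>2 * (h\<^sup>2 / 2)" using dt' by (intro mult_left_mono) auto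
      then have "y * y \<le> y * (x\<^sup>2 * (h\<^sup>2 / 2))" using y0 by (intro mult_left_mono) (auto simp: y_def)
      then show ?thesis by (simp add: A_def power2_eq_square)
    qed
    moreover have "y - z = S + T"
    proof -
      have "4 * (dt / h\<^sup>2) * \<theta>\<^sup>2 = dt / h\<^sup>2 * (x\<^sup>2 * h\<^sup>2 * s\<^sup>2)" unfolding q[symmetric] by simp
      also have "\<dots> = y * s\<^sup>2" using pos by (simp add: y_def)
      finally show ?thesis unfolding S_def T_def z_def right_diff_distrib by linarith
    qed
    moreover have "S \<le> C" unfolding S_def C_def using s2 y0 by (intro mult_left_mono) auto
    moreover have "0 \<le> S" unfolding S_def using s2 y0 by simp
    moreover have "0 \<le> T" unfolding T_def using sb pos by simp
    moreover have "T \<le> B"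
    proof -
      have "4 * \<theta>\<^sup>2 \<le> x\<^sup>2 * h\<^sup>2 * 1" unfolding q using s2 by (intro mult_left_mono) auto
      then have "(4 * \<theta>\<^sup>2)\<^sup>2 \<le> (x\<^sup>2 * h\<^sup>2)\<^sup>2" by (intro power_mono) auto
      then have "\<theta> ^ 4 \<le> x ^ 4 * h ^ 4 / 16" by (simp add: power_mult_distrib flip: power_mult)
      then have "\<theta>\<^sup>2 - (sin \<theta>)\<^sup>2 \<le> x ^ 4 * h ^ 4 / 48" using sb by linarith
      then have "4 * (dt / h\<^sup>2) * (\<theta>\<^sup>2 - (sin \<theta>)\<^sup>2) \<le> 4 * (dt / h\<^sup>2) * (x ^ 4 * h ^ 4 / 48)"
        using pos by (intro mult_left_mono) auto
      also have "\<dots> = y * (x\<^sup>2 * h\<^sup>2 / 12)" using pos by (simp add: y_def field_simps eval_nat_numeral)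
      finally show ?thesis by (simp only: T_def B_def)
    qed
    moreover have "y * (x\<^sup>2 * h\<^sup>2 / 3 + 2 * (1 - s)) = A + B + C"
      by (simp add: A_def B_def C_def algebra_simps)
    ultimately have "\<bar>exp (- y) - (1 - z)\<bar> \<le> y * (x\<^sup>2 * h\<^sup>2 / 3 + 2 * (1 - s))"
      using exp_minus_bounds(1)[OF less_imp_le[OF y0]] by linarith
    then show ?thesis using y0 by (simp only: diff_diff_eq2 add_diff_cancel_left') (intro divide_right_mono; simp)
  qed
  also have "\<dots> = 16 * (x\<^sup>2 * h\<^sup>2 / 3 + 2 * (1 - s))" using y0 by simp
  finally show ?thesis unfolding y_def z_def .
qed

lemma grid_dx_bounds:
  assumes "L > 0" "J \<ge> 2"
  shows "grid_dx L J > 0" "grid_dx L J \<le> L" "1 / real J \<le> grid_dx L J / L"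
proof -
  have "real J \<ge> 2" using assms(2) by simp
  then show "grid_dx L J > 0" "grid_dx L J \<le> L" "1 / real J \<le> grid_dx L J / L"
    using assms(1) by (auto simp: grid_dx_def field_simps)
qed

lemma grid_point_mem:
  assumes "L > 0" "J \<ge> 2" "k < J"
  shows "real k * grid_dx L J \<in> {0..L}"
proof -
  have "real k * grid_dx L J \<le> (real J - 1) * grid_dx L J"
    using assms(3) grid_dx_bounds(1)[OF assms(1,2)] by (intro mult_right_mono) auto
  also have "\<dots> = L" using assms(2) by (simp add: grid_dx_def)
  finally show ?thesis using grid_dx_bounds(1)[OF assms(1,2)] by simp
qed

text \<open>Modes with \<open>3 * p \<le> J\<close> meet the angle condition because pi < 4. For the
  others, \<open>J < 3 * p\<close> makes the trivial bound 2 at most 6p/J.\<close>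

lemma multiplier_error:
  assumes L: "L > 0" and J: "J \<ge> 2" and dt: "0 < dt" "dt / (grid_dx L J)\<^sup>2 \<le> 1/2" and p: "p \<ge> 1"
  shows "\<bar>exp (- ((real p)\<^sup>2 * pi\<^sup>2 * dt / L\<^sup>2)) ^ n -
      (1 - 4 * (dt / (grid_dx L J)\<^sup>2) * (sin (real p * pi / (2 * real J)))\<^sup>2) ^ n\<bar>
    \<le> 128 / L * grid_dx L J * (real p)\<^sup>2" (is "\<bar>?a ^ n - ?b ^ n\<bar> \<le> _")
proof -
  define h where "h = grid_dx L J"
  note h = grid_dx_bounds[OF L J, folded h_def]
  have J2: "real J \<ge> 2" using J by simp
  have p1: "real p \<ge> 1" using p by simp
  have pi16: "pi\<^sup>2 \<le> 16" using power_mono[of pi 4 2] pi_less_4 by simp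
  have pp: "real p \<le> (real p)\<^sup>2" "1 \<le> (real p)\<^sup>2" using p1 by (auto simp: self_le_power)
  have hp: "0 \<le> h / L" using h L by simp
  show ?thesis
  proof (cases "3 * p \<le> J")
    case True
    define x s where "x = real p * pi / L" and "s = (real J - 1) / real J"
    have s: "1/2 \<le> s" "s \<le> 1" "1 - s \<le> h / L" using J2 h(3) by (auto simp: s_def field_simps)
    have \<theta>: "2 * (real p * pi / (2 * real J)) = x * h * s"
      using L J2 by (simp add: x_def s_def h_def grid_dx_def field_simps)
    have "real p * pi / (2 * real J) \<le> real p * 4 / (2 * (3 * real p))"
      using True p1 pi_less_4 by (intro frac_le mult_left_mono) auto
    also have "\<dots> = 2/3" using p1 by simp
    finally have "\<bar>exp (- (x\<^sup>2 * dt)) ^ n - ?b ^ n\<bar> \<le> 16 * (x\<^sup>2 * h\<^sup>2 / 3 + 2 * (1 - s))"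
      unfolding h_def[symmetric] using L p1 h s dt \<theta>
      by (intro multiplier_error_resolved) (auto simp: x_def h_def)
    also have "\<dots> \<le> 16 * (((real p)\<^sup>2 * (h / L)) * 16 / 3 + 2 * ((real p)\<^sup>2 * (h / L)))"
    proof -
      \<comment> \<open>One power of the mesh size is given up, since only first order is
        claimed.\<close>
      have "(h / L)\<^sup>2 \<le> h / L" unfolding power2_eq_square
        using hp h(2) L by (intro mult_left_le) auto
      then have "(real p)\<^sup>2 * pi\<^sup>2 * (h / L)\<^sup>2 \<le> ((real p)\<^sup>2 * (h / L)) * 16"
        using pi16 mult_mono[of "pi\<^sup>2" 16 "(h / L)\<^sup>2" "h / L"]
        by (simp only: mult.assoc) (intro mult_left_mono; simp add: mult.commute)
      moreover have "x\<^sup>2 * h\<^sup>2 = (real p)\<^sup>2 * pi\<^sup>2 * (h / L)\<^sup>2"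
        by (simp add: x_def power_divide power_mult_distrib)
      moreover have "1 * (h / L) \<le> (real p)\<^sup>2 * (h / L)" using pp hp by (intro mult_right_mono) auto
      ultimately show ?thesis using s(3) by (intro mult_left_mono add_mono divide_right_mono) auto
    qed
    \<comment> \<open>The total is 16 * (16/3 + 2), which is below 128.\<close>
    also have "\<dots> \<le> 128 * ((real p)\<^sup>2 * (h / L))"
      using mult_nonneg_nonneg[OF zero_le_power2[of "real p"] hp] by argo
    finally show ?thesis by (simp add: x_def h_def power_divide power_mult_distrib mult_ac)
  next
    case False
    have b: "\<bar>?b\<bar> \<le> 1"
    proof -
      have "(dt / h\<^sup>2) * (sin (real p * pi / (2 * real J)))\<^sup>2 \<le> (1/2) * 1"
        using dt by (intro mult_mono) (auto simp: h_def abs_square_le_1)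
      moreover have "0 \<le> (dt / h\<^sup>2) * (sin (real p * pi / (2 * real J)))\<^sup>2"
        using dt by simp
      ultimately show ?thesis by (simp add: h_def abs_le_iff)
    qed
    have "\<bar>?b ^ n\<bar> \<le> 1" using b by (simp add: power_abs power_le_one)
    moreover have "\<bar>?a ^ n\<bar> \<le> 1" using dt by (simp add: power_le_one)
    ultimately have "\<bar>?a ^ n - ?b ^ n\<bar> \<le> 2" by linarith
    also have "2 \<le> 6 * real p * (1 / real J)" using False J2 by (simp add: field_simps)
    also have "\<dots> \<le> 6 * (real p)\<^sup>2 * (h / L)"
      using h(3) pp by (intro mult_mono) auto
    also have "\<dots> \<le> 128 * (real p)\<^sup>2 * (h / L)" using hp by (intro mult_right_mono) auto
    finally show ?thesis by (simp add: h_def mult_ac)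
  qed
qed

text \<open>The sampled cosine \<open>c\<close> is compared with the exact eigenvector
  \<open>d\<close>: both their distance and the multiplier error are of order \<open>h\<close>,
  uniformly in \<open>n\<close>.\<close>

lemma mode_error:
  assumes L: "L > 0" and J: "J \<ge> 2" and dt: "0 < dt" "dt / (grid_dx L J)\<^sup>2 \<le> 1/2" and p: "p \<ge> 1"
  shows "l2_norm J (\<lambda>j. exp (- ((real p)\<^sup>2 * pi\<^sup>2 * (real n * dt) / L\<^sup>2)) * grid_proj L J (cbasis L p) j
        - neumann_iter (dt / (grid_dx L J)\<^sup>2) J n (grid_proj L J (cbasis L p)) j)
    \<le> 300 / L * grid_dx L J * (real p) ^ 4"
proof -
  define h r where "h = grid_dx L J" and "r = dt / (grid_dx L J)\<^sup>2"
  define a where "a = exp (- ((real p)\<^sup>2 * pi\<^sup>2 * dt / L\<^sup>2))"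
  define b where "b = 1 - 4 * r * (sin (real p * pi / (2 * real J)))\<^sup>2"
  define c where "c = grid_proj L J (cbasis L p)"
  define d where "d j = sqrt 2 * cos (real p * pi * (real j + 1/2) / real J)" for j
  note h = grid_dx_bounds[OF L J, folded h_def]
  have r: "0 \<le> r" "r \<le> 1/2" using dt by (auto simp: r_def)
  have J2: "real J \<ge> 2" using J by simp
  have p1: "real p \<ge> 1" using p by simp
  have sqrt2: "sqrt 2 \<le> 2" by (simp add: real_le_lsqrt)
  have "real p ^ 1 \<le> real p ^ 4" "real p ^ 2 \<le> real p ^ 4" using p1 by (intro power_increasing; simp)+
  then have p4: "h / L * real p \<le> h / L * real p ^ 4" "h / L * (real p)\<^sup>2 \<le> h / L * real p ^ 4"
    using h L by (intro mult_left_mono; simp)+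
  have an: "exp (- ((real p)\<^sup>2 * pi\<^sup>2 * (real n * dt) / L\<^sup>2)) = a ^ n"
    unfolding a_def exp_of_nat_mult[symmetric] by (simp add: mult_ac)
  have d_iter: "neumann_iter r J n d i = b ^ n * d i" if "i < J" for i
    using that
  proof (induction n arbitrary: i)
    case (Suc n)
    have "neumann_iter r J (Suc n) d i = neumann_step r J (\<lambda>k. b ^ n * d k) i"
      using Suc by (auto intro: neumann_step_cong)
    also have "\<dots> = b ^ n * (b * d i)"
      unfolding d_def neumann_step_scale neumann_step_cos[OF Suc.prems] by (simp add: b_def)
    finally show ?case by (simp add: mult_ac)
  qed simp
  have cd: "l2_norm J (\<lambda>j. c j - d j) \<le> 4 * (h / L * real p ^ 4)"
  proof (rule l2_norm_le)
    fix j assume j: "j < J"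
    \<comment> \<open>The normalised grid point and cell midpoint differ most at the two ends, by
      half a cell.\<close>
    have "\<bar>real j / (real J - 1) - (real j + 1/2) / real J\<bar> \<le> 1 / (2 * real J)"
    proof -
      have "real j / (real J - 1) - (real j + 1/2) / real J = (real j - (real J - 1) / 2) / (real J * (real J - 1))"
        using J2 by (simp add: field_simps)
      moreover have "\<bar>real j - (real J - 1) / 2\<bar> \<le> (real J - 1) / 2"
        using j by (auto simp: abs_le_iff field_simps)
      then have "\<bar>real j - (real J - 1) / 2\<bar> / (real J * (real J - 1)) \<le> (real J - 1) / 2 / (real J * (real J - 1))"
        using J2 by (intro divide_right_mono) auto
      ultimately show ?thesis using J2 by (simp add: abs_mult)
    qed
    also have "1 / (2 * real J) \<le> h / L / 2" using h(3) by simp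
    finally have pos: "\<bar>real j / (real J - 1) - (real j + 1/2) / real J\<bar> \<le> h / L / 2" .
    have cj: "c j = sqrt 2 * cos (real p * pi * (real j / (real J - 1)))"
      using p L by (simp add: c_def grid_proj_def cbasis_def grid_dx_def mult.assoc)
    have lip: "\<bar>cos u - cos w\<bar> \<le> \<bar>u - w\<bar>" for u w :: real
    proof -
      have "\<bar>cos u - cos w\<bar> = 2 * \<bar>sin ((u + w) / 2)\<bar> * \<bar>sin ((w - u) / 2)\<bar>"
        by (simp add: cos_diff_cos abs_mult)
      also have "\<dots> \<le> 2 * 1 * \<bar>(w - u) / 2\<bar>" by (intro mult_mono abs_sin_x_le_abs_x) auto
      finally show ?thesis by simp
    qed
    have "\<bar>c j - d j\<bar> = sqrt 2 * \<bar>cos (real p * pi * (real j / (real J - 1))) - cos (real p * pi * (real j + 1/2) / real J)\<bar>"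
      unfolding cj d_def by (simp add: abs_mult flip: right_diff_distrib)
    also have "\<dots> \<le> 2 * (real p * pi * \<bar>real j / (real J - 1) - (real j + 1/2) / real J\<bar>)"
      using lip[of "real p * pi * (real j / (real J - 1))" "real p * pi * (real j + 1/2) / real J"] sqrt2
      by (intro mult_mono) (auto simp: abs_mult simp flip: right_diff_distrib times_divide_eq_right)
    also have "\<dots> \<le> 2 * (real p * 4 * (h / L / 2))"
      using pos pi_less_4 by (intro mult_mono) auto
    also have "\<dots> \<le> 4 * (h / L * real p ^ 4)" using p4 by simp
    finally show "\<bar>c j - d j\<bar> \<le> 4 * (h / L * real p ^ 4)" .
  qed (use h L in simp)
  have d2: "l2_norm J d \<le> 2"
    using sqrt2 by (intro l2_norm_le) (auto simp: d_def abs_mult intro: order_trans[OF mult_mono[of "sqrt 2" 2 _ 1]])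
  \<comment> \<open>Insert \<open>d\<close> on both sides: the exact factor acts on
    \<open>c - d\<close>, the multipliers differ on \<open>d\<close>, and the contractive scheme
    acts on \<open>c - d\<close>.\<close>
  have "l2_norm J (\<lambda>j. a ^ n * c j - neumann_iter r J n c j)
      = l2_norm J (\<lambda>j. (a ^ n * (c j - d j) + (a ^ n - b ^ n) * d j) + (- 1) * neumann_iter r J n (\<lambda>j. c j - d j) j)"
    by (intro l2_norm_cong) (simp add: neumann_iter_diff d_iter algebra_simps)
  also have "\<dots> \<le> (\<bar>a ^ n\<bar> * l2_norm J (\<lambda>j. c j - d j) + \<bar>a ^ n - b ^ n\<bar> * l2_norm J d)
      + \<bar>- 1\<bar> * l2_norm J (neumann_iter r J n (\<lambda>j. c j - d j))"
    unfolding l2_norm_scale[symmetric]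
    by (intro order_trans[OF l2_norm_triangle] add_mono order_refl)
  also have "\<dots> \<le> (1 * (4 * (h / L * real p ^ 4)) + (128 * (h / L * real p ^ 4)) * 2) + 1 * (4 * (h / L * real p ^ 4))"
  proof (intro add_mono mult_mono cd d2 l2_norm_nonneg)
    show "\<bar>a ^ n\<bar> \<le> 1" unfolding a_def using dt by (simp add: power_le_one)
    have "\<bar>a ^ n - b ^ n\<bar> \<le> 128 / L * h * (real p)\<^sup>2"
      unfolding a_def b_def r_def h_def by (rule multiplier_error) fact+
    also have "\<dots> \<le> 128 * (h / L * real p ^ 4)" using p4 by simp
    finally show "\<bar>a ^ n - b ^ n\<bar> \<le> 128 * (h / L * real p ^ 4)" .
    show "l2_norm J (neumann_iter r J n (\<lambda>j. c j - d j)) \<le> 4 * (h / L * real p ^ 4)"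
      using l2_norm_neumann_iter[OF r] cd by (rule order_trans)
  qed (use h L in auto)
  \<comment> \<open>The contributions add up to 4 + 256 + 4 = 264.\<close>
  also have "\<dots> \<le> 300 * (h / L * real p ^ 4)"
  proof -
    have "0 \<le> h / L * real p ^ 4" using h L by simp
    then show ?thesis by argo
  qed
  finally show ?thesis unfolding an c_def r_def h_def by (simp add: mult_ac)
qed

section \<open>Cosine series on an interval\<close>

text \<open>The frequency is an integer because product-to-sum formulas produce differences of
  either sign.\<close>

lemma has_integral_cos_multiple:
  fixes L :: real and m :: int
  assumes "L > 0"
  shows "((\<lambda>x. cos (of_int m * pi * x / L)) has_integral (if m = 0 then L else 0)) {0..L}"
proof (cases "m = 0")
  case True
  then show ?thesis using has_integral_const_real[of "1::real" 0 L] assms by simp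
next
  case False
  have "((\<lambda>x. cos (of_int m * pi * x / L)) has_integral
      (sin (of_int m * pi * L / L) * L / (of_int m * pi) - sin (of_int m * pi * 0 / L) * L / (of_int m * pi))) {0..L}"
    using assms False
    by (intro fundamental_theorem_of_calculus)
      (auto intro!: derivative_eq_intros simp flip: has_real_derivative_iff_has_vector_derivative)
  then show ?thesis using False assms by (simp add: sin_int_times_real mult.commute)
qed

lemma sin_orthogonal:
  fixes L :: real
  assumes "L > 0" "p \<ge> 1" "q \<ge> 1"
  shows "integral {0..L} (\<lambda>x. sin (real p * pi * x / L) * sin (real q * pi * x / L)) = (if p = q then L / 2 else 0)"
proof -
  have "((\<lambda>x. (cos (of_int (int p - int q) * pi * x / L) - cos (of_int (int p + int q) * pi * x / L)) / 2) has_integral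
    ((if int p - int q = 0 then L else 0) - (if int p + int q = 0 then L else 0)) / 2) {0..L}"
    by (intro has_integral_divide has_integral_diff has_integral_cos_multiple assms)
  moreover have "(cos (of_int (int p - int q) * pi * x / L) - cos (of_int (int p + int q) * pi * x / L)) / 2
      = sin (real p * pi * x / L) * sin (real q * pi * x / L)" for x
    by (simp add: sin_times_sin algebra_simps diff_divide_distrib add_divide_distrib)
  ultimately show ?thesis using assms by (subst integral_unique) auto
qed

lemma cbasis_orthonormal:
  fixes L :: real
  assumes "L > 0"
  shows "integral {0..L} (\<lambda>x. cbasis L p x * cbasis L q x) = (if p = q then L else 0)"
proof -
  define k where "k m = (if m = (0::nat) then 1 else sqrt 2)" for m
  have cb: "cbasis L m x = k m * cos (of_int (int m) * pi * x / L)" for m x by (simp add: cbasis_def k_def)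
  have "((\<lambda>x. k p * k q * ((cos (of_int (int p - int q) * pi * x / L) + cos (of_int (int p + int q) * pi * x / L)) / 2)) has_integral
    k p * k q * (((if int p - int q = 0 then L else 0) + (if int p + int q = 0 then L else 0)) / 2)) {0..L}"
    by (intro has_integral_mult_right has_integral_divide has_integral_add has_integral_cos_multiple assms)
  moreover have "k p * k q * ((cos (of_int (int p - int q) * pi * x / L) + cos (of_int (int p + int q) * pi * x / L)) / 2)
      = cbasis L p x * cbasis L q x" for x
    unfolding cb by (simp add: cos_times_cos algebra_simps diff_divide_distrib add_divide_distrib)
  moreover have "k p * k q * (((if int p - int q = 0 then L else 0) + (if int p + int q = 0 then L else 0)) / 2)
      = (if p = q then L else 0)"
    by (simp add: k_def)
  ultimately show ?thesis by (simp only: integral_unique)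
qed

text \<open>Expand the nonnegative integral of \<open>(f - S)\<^sup>2\<close>, where
  \<open>S\<close> is the orthogonal projection of \<open>f\<close> onto the span of the
  family.\<close>

lemma bessel_inequality:
  fixes f :: "real \<Rightarrow> real" and e :: "nat \<Rightarrow> real \<Rightarrow> real"
  assumes f: "continuous_on {a..b} f" and e: "\<And>p. p \<in> A \<Longrightarrow> continuous_on {a..b} (e p)" and "finite A" "c > 0"
    and orth: "\<And>p q. p \<in> A \<Longrightarrow> q \<in> A \<Longrightarrow> integral {a..b} (\<lambda>x. e p x * e q x) = (if p = q then c else 0)"
  shows "(\<Sum>p\<in>A. (integral {a..b} (\<lambda>x. f x * e p x))\<^sup>2) \<le> c * integral {a..b} (\<lambda>x. (f x)\<^sup>2)"
proof -
  define \<beta> where "\<beta> p = integral {a..b} (\<lambda>x. f x * e p x)" for p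
  define S where "S x = (\<Sum>p\<in>A. \<beta> p / c * e p x)" for x
  have S: "continuous_on {a..b} S" unfolding S_def using e by (intro continuous_intros) auto
  have int: "(\<lambda>x. u x * w x) integrable_on {a..b}" if "continuous_on {a..b} u" "continuous_on {a..b} w" for u w :: "real \<Rightarrow> real"
    using that by (intro integrable_continuous_real continuous_intros)
  have uS: "integral {a..b} (\<lambda>x. u x * S x) = (\<Sum>p\<in>A. \<beta> p / c * integral {a..b} (\<lambda>x. u x * e p x))"
    if u: "continuous_on {a..b} u" for u
  proof -
    have "integral {a..b} (\<lambda>x. u x * S x) = integral {a..b} (\<lambda>x. \<Sum>p\<in>A. \<beta> p / c * (u x * e p x))"
      by (simp add: S_def sum_distrib_left mult_ac)
    also have "\<dots> = (\<Sum>p\<in>A. integral {a..b} (\<lambda>x. \<beta> p / c * (u x * e p x)))"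
      by (intro integral_sum integrable_on_mult_right int[OF u] e assms(3))
    finally show ?thesis by simp
  qed
  have fS: "integral {a..b} (\<lambda>x. f x * S x) = (\<Sum>p\<in>A. (\<beta> p)\<^sup>2) / c"
    unfolding uS[OF f] by (simp add: \<beta>_def power2_eq_square sum_divide_distrib)
  have eS: "integral {a..b} (\<lambda>x. S x * e p x) = \<beta> p" if "p \<in> A" for p
  proof -
    have "integral {a..b} (\<lambda>x. e p x * S x) = (\<Sum>q\<in>A. \<beta> q / c * (if p = q then c else 0))"
      unfolding uS[OF e[OF that]] using orth[OF that] by (intro sum.cong) auto
    also have "\<dots> = \<beta> p" using that assms(3,4) by (simp add: if_distrib sum.delta' cong: if_cong)
    finally show ?thesis by (simp add: mult.commute)
  qed
  have SS: "integral {a..b} (\<lambda>x. S x * S x) = (\<Sum>p\<in>A. (\<beta> p)\<^sup>2) / c"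
    unfolding uS[OF S] by (simp add: eS power2_eq_square sum_divide_distrib)
  have "0 \<le> integral {a..b} (\<lambda>x. (f x - S x)\<^sup>2)"
    by (intro integral_nonneg integrable_continuous_real continuous_intros f S) auto
  also have "\<dots> = integral {a..b} (\<lambda>x. (f x * f x - 2 * (f x * S x)) + S x * S x)"
    by (simp add: power2_eq_square algebra_simps)
  also have "\<dots> = integral {a..b} (\<lambda>x. f x * f x) - 2 * integral {a..b} (\<lambda>x. f x * S x) + integral {a..b} (\<lambda>x. S x * S x)"
    by (subst integral_add integral_diff integral_mult_right; (intro integrable_diff integrable_on_mult_right int f S)?)+ (rule refl)
  also have "\<dots> = integral {a..b} (\<lambda>x. f x * f x) - (\<Sum>p\<in>A. (\<beta> p)\<^sup>2) / c"
    unfolding fS SS by simp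
  finally show ?thesis using \<open>c > 0\<close> by (simp add: \<beta>_def power2_eq_square field_simps)
qed

text \<open>In the variable cos(pi x/L), orthogonality to all cosines becomes orthogonality to all
  polynomials, which are uniformly dense.\<close>

lemma cosine_completeness:
  fixes h :: "real \<Rightarrow> real"
  assumes L: "L > 0" and h: "continuous_on {0..L} h"
    and orth: "\<And>p. integral {0..L} (\<lambda>x. h x * cos (real p * pi * x / L)) = 0"
    and x: "x \<in> {0..L}"
  shows "h x = 0"
proof -
  define c where "c x = cos (pi * x / L)" for x
  have cc: "continuous_on A c" for A unfolding c_def using L by (intro continuous_intros) auto
  have int: "u integrable_on {0..L}" if "continuous_on {0..L} u" for u :: "real \<Rightarrow> real"
    using that by (rule integrable_continuous_real)
  \<comment> \<open>Keeping a free cosine factor makes the induction work: one more power of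
    \<open>c\<close> only shifts its frequency by one either way. At frequency 0 both shifts give
    1.\<close>
  have pow: "integral {0..L} (\<lambda>x. h x * (c x ^ i * cos (real p * pi * x / L))) = 0" for i p
  proof (induction i arbitrary: p)
    case (Suc i)
    obtain q where q: "c x * cos (real p * pi * x / L) =
      (cos (real (Suc p) * pi * x / L) + cos (real q * pi * x / L)) / 2" for x
    proof (cases p)
      case 0
      then show ?thesis by (intro that[of 1]) (simp add: c_def)
    next
      case (Suc q)
      have "c x * cos (real p * pi * x / L) =
        (cos (real (Suc p) * pi * x / L) + cos (real q * pi * x / L)) / 2" for x
        unfolding c_def cos_times_cos Suc 
        by (subst cos_minus[symmetric]) (simp add: algebra_simps add_divide_distrib diff_divide_distrib)
      then show ?thesis by (rule that)
    qed
    have "integral {0..L} (\<lambda>x. h x * (c x ^ Suc i * cos (real p * pi * x / L))) =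
      integral {0..L} (\<lambda>x. (h x * (c x ^ i * cos (real (Suc p) * pi * x / L)) + h x * (c x ^ i * cos (real q * pi * x / L))) / 2)"
    proof (rule integral_cong)
      fix x
      have "h x * (c x ^ Suc i * cos (real p * pi * x / L)) = h x * c x ^ i * (c x * cos (real p * pi * x / L))"
        by simp
      then show "h x * (c x ^ Suc i * cos (real p * pi * x / L)) =
        (h x * (c x ^ i * cos (real (Suc p) * pi * x / L)) + h x * (c x ^ i * cos (real q * pi * x / L))) / 2"
        unfolding q by (simp add: algebra_simps)
    qed
    also have "\<dots> = 0"
      unfolding integral_divide
      by (subst integral_add) (use Suc L in \<open>auto intro!: int continuous_intros h cc simp del: of_nat_Suc\<close>)
    finally show ?case .
  qed (simp add: orth)
  have pow': "((\<lambda>x. h x * c x ^ i) has_integral 0) {0..L}" for i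
  proof -
    have "continuous_on {0..L} (\<lambda>x. h x * c x ^ i)" by (intro continuous_intros h cc)
    from integrable_integral[OF int[OF this]] pow[of i 0] show ?thesis by simp
  qed
  define B where "B = integral {0..L} (\<lambda>x. \<bar>h x\<bar>)"
  have B0: "0 \<le> B" unfolding B_def by (intro integral_nonneg int continuous_intros h) auto
  \<comment> \<open>One factor \<open>h\<close> is replaced by its polynomial approximation, whose
    integral against \<open>h\<close> vanishes.\<close>
  have small: "integral {0..L} (\<lambda>x. h x * h x) \<le> e * B" if e: "e > 0" for e
  proof -
    have "continuous_on {-1..1} (\<lambda>y. h (L / pi * arccos y))"
      using L by (intro continuous_on_compose2[OF h] continuous_intros)
        (auto simp: field_simps arccos_lbound arccos_ubound)
    then obtain g where g: "real_polynomial_function g" "\<And>y. y \<in> {-1..1} \<Longrightarrow> \<bar>h (L / pi * arccos y) - g y\<bar> < e"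
      using Stone_Weierstrass_real_polynomial_function[of "{-1..1::real}", OF _ _ e] by auto
    from g(1) obtain a n where gs: "g = (\<lambda>y. \<Sum>i\<le>n. a i * y ^ i)"
      unfolding real_polynomial_function_iff_sum by auto
    have near: "\<bar>h x - g (c x)\<bar> \<le> e" if "x \<in> {0..L}" for x
    proof -
      have "arccos (c x) = pi * x / L" unfolding c_def
        using that L by (intro arccos_cos) (auto simp: field_simps)
      then show ?thesis using g(2)[of "c x"] L by (simp add: c_def)
    qed
    have cg: "continuous_on {0..L} (\<lambda>x. g (c x))" unfolding gs by (intro continuous_intros cc)
    have "((\<lambda>x. \<Sum>i\<le>n. a i * (h x * c x ^ i)) has_integral (\<Sum>i\<le>n. a i * 0)) {0..L}"
      by (intro has_integral_sum has_integral_mult_right pow') auto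
    then have "integral {0..L} (\<lambda>x. h x * g (c x)) = 0"
      by (intro integral_unique) (simp add: gs sum_distrib_left mult_ac)
    then have "integral {0..L} (\<lambda>x. h x * h x) = integral {0..L} (\<lambda>x. h x * h x) - integral {0..L} (\<lambda>x. h x * g (c x))"
      by simp
    also have "\<dots> = integral {0..L} (\<lambda>x. h x * h x - h x * g (c x))"
      by (intro integral_diff[symmetric] int continuous_intros h cg)
    also have "\<dots> \<le> integral {0..L} (\<lambda>x. e * \<bar>h x\<bar>)"
    proof (intro integral_le int continuous_intros h cg)
      fix x assume "x \<in> {0..L}"
      then have "\<bar>h x\<bar> * \<bar>h x - g (c x)\<bar> \<le> \<bar>h x\<bar> * e" by (intro mult_left_mono near) auto
      then show "h x * h x - h x * g (c x) \<le> e * \<bar>h x\<bar>"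
        unfolding right_diff_distrib[symmetric] by (metis abs_ge_self abs_mult mult.commute order_trans)
    qed
    also have "\<dots> = e * B" by (simp add: B_def)
    finally show ?thesis .
  qed
  have "integral {0..L} (\<lambda>x. h x * h x) \<le> 0"
  proof (rule field_le_epsilon)
    fix e :: real assume e: "e > 0"
    \<comment> \<open>Dividing by \<open>B + 1\<close> also covers the case
      \<open>B = 0\<close>.\<close>
    have "e / (B + 1) * B \<le> e" using e B0 by (simp add: field_simps)
    with small[of "e / (B + 1)"] e B0 show "integral {0..L} (\<lambda>x. h x * h x) \<le> 0 + e" by auto
  qed
  moreover have "0 \<le> integral {0..L} (\<lambda>x. h x * h x)" by (intro integral_nonneg int continuous_intros h) auto
  ultimately have "integral {0..L} (\<lambda>x. h x * h x) = 0" by simp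
  moreover have "continuous_on {0..L} (\<lambda>x. h x * h x)" by (intro continuous_intros h)
  ultimately have "\<forall>x\<in>{0..L}. h x * h x = 0" using integral_eq_0_iff[OF _ L] by simp
  then show ?thesis using x by simp
qed

lemma abs_cbasis_le: "\<bar>cbasis L p x\<bar> \<le> 2"
proof -
  have "sqrt 2 * \<bar>cos (real p * pi * x / L)\<bar> \<le> 2 * 1"
    by (intro mult_mono) (auto simp: real_le_lsqrt)
  then show ?thesis by (auto simp: cbasis_def abs_mult)
qed

lemma continuous_on_cbasis: "L > 0 \<Longrightarrow> continuous_on A (cbasis L p)"
  unfolding cbasis_def by (cases "p = 0") (auto intro!: continuous_intros)

text \<open>The series converges uniformly to a continuous \<open>F\<close> with the same
  coefficients as \<open>f\<close>, so completeness applied to \<open>F - f\<close> identifies the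
  two.\<close>

lemma cosine_series_sums:
  fixes f :: "real \<Rightarrow> real"
  assumes L: "L > 0" and f: "continuous_on {0..L} f" and sm: "summable (\<lambda>p. \<bar>coeff L f p\<bar>)" and x: "x \<in> {0..L}"
  shows "(\<lambda>p. coeff L f p * cbasis L p x) sums f x"
proof -
  define F where "F x = (\<Sum>p. coeff L f p * cbasis L p x)" for x
  define S where "S N x = (\<Sum>p<N. coeff L f p * cbasis L p x)" for N x
  have bd: "norm (coeff L f p * cbasis L p x) \<le> \<bar>coeff L f p\<bar> * 2" for p x
    using abs_cbasis_le by (auto simp: abs_mult intro: mult_left_mono)
  have sm2: "summable (\<lambda>p. \<bar>coeff L f p\<bar> * 2)" using sm by (rule summable_mult2)
  have ul: "uniform_limit {0..L} S F sequentially"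
    unfolding S_def F_def using bd sm2 by (intro Weierstrass_m_test) auto
  have cS: "continuous_on {0..L} (S N)" for N unfolding S_def by (intro continuous_intros continuous_on_cbasis L)
  have cF: "continuous_on {0..L} F"
    by (rule uniform_limit_theorem[OF _ ul]) (use cS in auto)
  have coeffF: "integral {0..L} (\<lambda>x. F x * cbasis L q x) = L * coeff L f q" for q
  proof -
    have "uniform_limit {0..L} (\<lambda>N x. S N x * cbasis L q x) (\<lambda>x. F x * cbasis L q x) sequentially"
      by (intro uniform_lim_mult ul uniform_limit_const compact_imp_bounded compact_continuous_image cF continuous_on_cbasis L compact_Icc)
    then obtain I K where IK: "\<And>N. ((\<lambda>x. S N x * cbasis L q x) has_integral I N) {0..L}"
      "((\<lambda>x. F x * cbasis L q x) has_integral K) {0..L}" "I \<longlonglongrightarrow> K"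
      by (rule uniform_limit_integral) (auto intro!: continuous_intros cS continuous_on_cbasis L)
    \<comment> \<open>By orthogonality the coefficient is exact once the partial sum contains mode
      \<open>q\<close>, so the sequence is eventually constant.\<close>
    have "I N = L * coeff L f q" if "N > q" for N
    proof -
      have "((\<lambda>x. \<Sum>p<N. coeff L f p * (cbasis L p x * cbasis L q x)) has_integral
          (\<Sum>p<N. coeff L f p * (if p = q then L else 0))) {0..L}"
      proof (intro has_integral_sum has_integral_mult_right finite_lessThan)
        fix p
        have "(\<lambda>x. cbasis L p x * cbasis L q x) integrable_on {0..L}"
          by (intro integrable_continuous_real continuous_intros continuous_on_cbasis L)
        from integrable_integral[OF this]
        show "((\<lambda>x. cbasis L p x * cbasis L q x) has_integral (if p = q then L else 0)) {0..L}"
          unfolding cbasis_orthonormal[OF L] .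
      qed
      moreover have "(\<Sum>p<N. coeff L f p * (if p = q then L else 0)) = (\<Sum>p<N. if p = q then coeff L f q * L else 0)"
        by (intro sum.cong) auto
      ultimately have "((\<lambda>x. S N x * cbasis L q x) has_integral L * coeff L f q) {0..L}"
        using that by (simp add: S_def sum_distrib_right mult.assoc mult.commute[of L])
      then show ?thesis using IK(1) has_integral_unique by blast
    qed
    then have "I \<longlonglongrightarrow> L * coeff L f q"
      by (intro tendsto_eventually eventually_sequentiallyI[of "Suc q"]) auto
    then show ?thesis using IK LIMSEQ_unique by blast
  qed
  have "F x - f x = 0"
  proof (rule cosine_completeness[OF L _ _ x])
    show "continuous_on {0..L} (\<lambda>x. F x - f x)" by (intro continuous_intros cF f)
    fix q :: nat
    define k where "k = (if q = 0 then 1 else sqrt 2)"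
    have k: "k \<noteq> 0" "cbasis L q x = k * cos (real q * pi * x / L)" for x by (auto simp: k_def cbasis_def)
    have "0 = integral {0..L} (\<lambda>x. F x * cbasis L q x) - integral {0..L} (\<lambda>x. f x * cbasis L q x)"
      unfolding coeffF using L by (simp add: coeff_def)
    also have "\<dots> = integral {0..L} (\<lambda>x. F x * cbasis L q x - f x * cbasis L q x)"
      by (intro integral_diff[symmetric] integrable_continuous_real continuous_intros cF f continuous_on_cbasis L)
    also have "\<dots> = integral {0..L} (\<lambda>x. k * ((F x - f x) * cos (real q * pi * x / L)))"
      by (simp add: k algebra_simps)
    finally show "integral {0..L} (\<lambda>x. (F x - f x) * cos (real q * pi * x / L)) = 0"
      using k by simp
  qed
  moreover have "summable (\<lambda>p. coeff L f p * cbasis L p x)"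
    using bd sm2 by (rule summable_comparison_test'[where N = 0, rotated])
  ultimately show ?thesis unfolding F_def by (simp add: sums_iff)
qed

section \<open>Decay of the coefficients\<close>

lemma sobolev_family_continuous:
  assumes "sobolev_family L k g" "j < k"
  shows "continuous_on {0..L} (g j)"
proof -
  have g: "g (Suc j) integrable_on {0..L}" "\<And>x. x \<in> {0..L} \<Longrightarrow> g j x = g j 0 + integral {0..x} (g (Suc j))"
    using assms Suc_leI unfolding sobolev_family_def by blast+
  have "continuous_on {0..L} (\<lambda>x. g j 0 + integral {0..x} (g (Suc j)))"
    by (intro continuous_intros indefinite_integral_continuous_1 g)
  then show ?thesis by (rule continuous_on_eq) (rule g(2)[symmetric])
qed

text \<open>The integrand \<open>g (Suc j)\<close> is continuous below the top order, so the
  derivative there is classical at every point.\<close>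

lemma sobolev_family_deriv:
  assumes "sobolev_family L k g" "Suc j < k" "x \<in> {0..L}"
  shows "(g j has_real_derivative g (Suc j) x) (at x within {0..L})"
proof -
  have "continuous_on {0..L} (g (Suc j))"
    using assms by (intro sobolev_family_continuous)
  from integral_has_real_derivative[OF this assms(3)]
  have "((\<lambda>x. g j 0 + integral {0..x} (g (Suc j))) has_real_derivative g (Suc j) x) (at x within {0..L})"
    by (auto intro!: derivative_eq_intros)
  then show ?thesis
  proof (rule has_field_derivative_transform_within[OF _ zero_less_one assms(3)])
    show "g j 0 + integral {0..y} (g (Suc j)) = g j y" if "y \<in> {0..L}" for y
      using assms(1) Suc_lessD[OF assms(2)] that unfolding sobolev_family_def by metis
  qed
qed

section \<open>Integration by parts against cosines and sines\<close>

lemma integral_by_parts_on_interval: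
  fixes f f' u u' :: "real \<Rightarrow> real"
  assumes "a \<le> b"
    and f: "\<And>x. x \<in> {a..b} \<Longrightarrow> (f has_real_derivative f' x) (at x within {a..b})" "continuous_on {a..b} f'"
    and u: "\<And>x. x \<in> {a..b} \<Longrightarrow> (u has_real_derivative u' x) (at x within {a..b})" "continuous_on {a..b} u'"
  shows "integral {a..b} (\<lambda>x. f x * u' x) = f b * u b - f a * u a - integral {a..b} (\<lambda>x. f' x * u x)"
proof -
  have c: "continuous_on {a..b} f" "continuous_on {a..b} u"
    using f(1) u(1) by (blast intro: DERIV_continuous_on)+
  have "((\<lambda>x. f x * u' x + f' x * u x) has_integral f b * u b - f a * u a) {a..b}"
    using assms(1) f(1) u(1)
    by (intro fundamental_theorem_of_calculus)
      (auto intro!: derivative_eq_intros simp flip: has_real_derivative_iff_has_vector_derivative)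
  moreover have "((\<lambda>x. f' x * u x) has_integral integral {a..b} (\<lambda>x. f' x * u x)) {a..b}"
    by (intro integrable_integral integrable_continuous_real continuous_intros f c)
  ultimately have "((\<lambda>x. f x * u' x + f' x * u x - f' x * u x) has_integral
      f b * u b - f a * u a - integral {a..b} (\<lambda>x. f' x * u x)) {a..b}"
    by (rule has_integral_diff)
  then show ?thesis by (intro integral_unique) simp
qed

text \<open>The boundary terms vanish because the sine is zero at both ends, whatever the values of
  \<open>f\<close>.\<close>

lemma integral_cos_by_parts:
  fixes f f' :: "real \<Rightarrow> real"
  assumes L: "L > 0" and p: "p \<ge> 1"
    and f: "\<And>x. x \<in> {0..L} \<Longrightarrow> (f has_real_derivative f' x) (at x within {0..L})" "continuous_on {0..L} f'"
  shows "integral {0..L} (\<lambda>x. f x * cos (real p * pi * x / L)) =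
    - (L / (real p * pi)) * integral {0..L} (\<lambda>x. f' x * sin (real p * pi * x / L))"
proof -
  have "integral {0..L} (\<lambda>x. f x * cos (real p * pi * x / L)) =
    f L * (L / (real p * pi) * sin (real p * pi * L / L)) - f 0 * (L / (real p * pi) * sin (real p * pi * 0 / L))
    - integral {0..L} (\<lambda>x. f' x * (L / (real p * pi) * sin (real p * pi * x / L)))"
    using L p by (intro integral_by_parts_on_interval f) (auto intro!: derivative_eq_intros continuous_intros)
  also have "(\<lambda>x. f' x * (L / (real p * pi) * sin (real p * pi * x / L))) =
     (\<lambda>x. L / (real p * pi) * (f' x * sin (real p * pi * x / L)))"
    by (simp add: fun_eq_iff)
  finally show ?thesis using L by (simp only: integral_mult_right) simp
qed

lemma integral_sin_by_parts:
  fixes f f' :: "real \<Rightarrow> real"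
  assumes L: "L > 0" and p: "p \<ge> 1" and bdry: "f 0 = 0" "f L = 0"
    and f: "\<And>x. x \<in> {0..L} \<Longrightarrow> (f has_real_derivative f' x) (at x within {0..L})" "continuous_on {0..L} f'"
  shows "integral {0..L} (\<lambda>x. f x * sin (real p * pi * x / L)) =
    (L / (real p * pi)) * integral {0..L} (\<lambda>x. f' x * cos (real p * pi * x / L))"
proof -
  have "integral {0..L} (\<lambda>x. f x * sin (real p * pi * x / L)) =
    f L * (- (L / (real p * pi)) * cos (real p * pi * L / L)) - f 0 * (- (L / (real p * pi)) * cos (real p * pi * 0 / L))
    - integral {0..L} (\<lambda>x. f' x * (- (L / (real p * pi)) * cos (real p * pi * x / L)))"
    using L p by (intro integral_by_parts_on_interval f) (auto intro!: derivative_eq_intros continuous_intros)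
  also have "(\<lambda>x. f' x * (- (L / (real p * pi)) * cos (real p * pi * x / L))) =
     (\<lambda>x. - (L / (real p * pi)) * (f' x * cos (real p * pi * x / L)))"
    by (simp add: fun_eq_iff)
  finally show ?thesis unfolding bdry by (simp only: integral_mult_right)
qed

text \<open>Five integrations by parts, alternating cosine and sine; the boundary values of
  \<open>g 1\<close> and \<open>g 3\<close> enter at the two sine steps.\<close>

lemma coeff_eq_fifth_derivative:
  assumes L: "L > 0" and p: "p \<ge> 1" and g: "sobolev_family L 6 g"
    and bdry: "g 1 0 = 0" "g 1 L = 0" "g 3 0 = 0" "g 3 L = 0"
  shows "coeff L (g 0) p =
    - (sqrt 2 / L * (L / (real p * pi)) ^ 5) * integral {0..L} (\<lambda>x. g 5 x * sin (real p * pi * x / L))"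
proof -
  define k where "k = L / (real p * pi)"
  note d = sobolev_family_deriv[OF g, simplified] and c = sobolev_family_continuous[OF g]
  have cosstep: "integral {0..L} (\<lambda>x. g j x * cos (real p * pi * x / L)) =
    - k * integral {0..L} (\<lambda>x. g (Suc j) x * sin (real p * pi * x / L))" if "Suc j < 6" for j
    unfolding k_def using that by (intro integral_cos_by_parts L p d c) auto
  have sinstep: "integral {0..L} (\<lambda>x. g j x * sin (real p * pi * x / L)) =
    k * integral {0..L} (\<lambda>x. g (Suc j) x * cos (real p * pi * x / L))"
    if "Suc j < 6" "g j 0 = 0" "g j L = 0" for j
    unfolding k_def using that by (intro integral_sin_by_parts L p d c) auto
  have "coeff L (g 0) p = sqrt 2 / L * integral {0..L} (\<lambda>x. g 0 x * cos (real p * pi * x / L))"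
  proof -
    have "(\<lambda>x. g 0 x * cbasis L p x) = (\<lambda>x. sqrt 2 * (g 0 x * cos (real p * pi * x / L)))"
      using p by (simp add: cbasis_def fun_eq_iff)
    then show ?thesis by (simp add: coeff_def)
  qed
  then show ?thesis
    using cosstep[of 0] sinstep[of 1] cosstep[of 2] sinstep[of 3] cosstep[of 4] bdry
    by (simp add: eval_nat_numeral flip: k_def)
qed

text \<open>Five derivatives against the weight p^4 leave \<open>\<beta> p\<close> divided by the
  frequency; this is at most the sum of two squares, summable by Bessel and by the inverse-square
  series.\<close>

lemma summable_coeff:
  assumes L: "L > 0" and g: "sobolev_family L 6 g"
    and bdry: "g 1 0 = 0" "g 1 L = 0" "g 3 0 = 0" "g 3 L = 0"
  shows "summable (\<lambda>p. \<bar>coeff L (g 0) (Suc p)\<bar> * real (Suc p) ^ 4)"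
proof -
  define e where "e p x = sin (real (Suc p) * pi * x / L)" for p x
  define \<beta> where "\<beta> p = integral {0..L} (\<lambda>x. g 5 x * e p x)" for p
  define K where "K = sqrt 2 / L * (L / pi) ^ 5"
  have K: "K \<ge> 0" using L by (simp add: K_def)
  have "(\<Sum>p<N. (\<beta> p)\<^sup>2) \<le> L / 2 * integral {0..L} (\<lambda>x. (g 5 x)\<^sup>2)" for N
    unfolding \<beta>_def
  proof (rule bessel_inequality)
    show "continuous_on {0..L} (g 5)" by (rule sobolev_family_continuous[OF g]) simp
    show "continuous_on {0..L} (e p)" for p
      unfolding e_def using L by (intro continuous_intros) auto
    show "integral {0..L} (\<lambda>x. e p x * e q x) = (if p = q then L / 2 else 0)" for p q
      unfolding e_def using sin_orthogonal[OF L, of "Suc p" "Suc q"] by simp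
  qed (use L in auto)
  then have "summable (\<lambda>p. (\<beta> p)\<^sup>2)" by (intro summableI_nonneg_bounded[where x = "L / 2 * integral {0..L} (\<lambda>x. (g 5 x)\<^sup>2)"]) auto
  moreover have "summable (\<lambda>p. inverse (real (Suc p) ^ 2))"
    by (subst summable_Suc_iff) (simp add: inverse_power_summable)
  ultimately have "summable (\<lambda>p. K * ((\<beta> p)\<^sup>2 + inverse (real (Suc p) ^ 2)))"
    by (intro summable_mult summable_add)
  then show ?thesis
  proof (rule summable_comparison_test'[where N = 0])
    fix p
    define m where "m = real (Suc p)"
    have m: "m > 0" by (simp add: m_def)
    have eq: "\<bar>coeff L (g 0) (Suc p)\<bar> * m ^ 4 = K * (\<bar>\<beta> p\<bar> * inverse m)"
    proof -
      have "coeff L (g 0) (Suc p) = - (sqrt 2 / L * (L / (m * pi)) ^ 5) * \<beta> p"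
        unfolding m_def \<beta>_def e_def by (rule coeff_eq_fifth_derivative[OF L _ g bdry]) simp
      also have "sqrt 2 / L * (L / (m * pi)) ^ 5 = K / m ^ 5"
        by (simp add: K_def power_divide power_mult_distrib)
      finally have "\<bar>coeff L (g 0) (Suc p)\<bar> = K / m ^ 5 * \<bar>\<beta> p\<bar>" using m K by (simp add: abs_mult)
      then show ?thesis using m by (simp add: field_simps eval_nat_numeral)
    qed
    have le: "\<bar>\<beta> p\<bar> * inverse m \<le> (\<beta> p)\<^sup>2 + (inverse m)\<^sup>2"
    proof -
      have "2 * (\<bar>\<beta> p\<bar> * inverse m) \<le> (\<beta> p)\<^sup>2 + (inverse m)\<^sup>2"
        using sum_squares_bound[of "\<bar>\<beta> p\<bar>" "inverse m"] by simp
      moreover have "0 \<le> \<bar>\<beta> p\<bar> * inverse m" using m by simp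
      ultimately show ?thesis by argo
    qed
    have "norm (\<bar>coeff L (g 0) (Suc p)\<bar> * real (Suc p) ^ 4) = \<bar>coeff L (g 0) (Suc p)\<bar> * m ^ 4"
      using m unfolding m_def[symmetric] by (simp add: abs_mult)
    also have "\<dots> \<le> K * ((\<beta> p)\<^sup>2 + (inverse m)\<^sup>2)"
      unfolding eq by (intro mult_left_mono le K)
    also have "\<dots> = K * ((\<beta> p)\<^sup>2 + inverse (real (Suc p) ^ 2))"
      by (simp only: m_def power_inverse)
    finally show "norm (\<bar>coeff L (g 0) (Suc p)\<bar> * real (Suc p) ^ 4) \<le> K * ((\<beta> p)\<^sup>2 + inverse (real (Suc p) ^ 2))" .
  qed
qed

text \<open>Shows that the scheme reproduces the zero mode exactly, without error.\<close>

lemma neumann_iter_const: "neumann_iter r J n (\<lambda>_. c) = (\<lambda>_. c)"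
proof (induction n)
  case (Suc n)
  have "neumann_step r J (\<lambda>_. c) = (\<lambda>_. c)" by (simp add: neumann_step_def fun_eq_iff)
  with Suc show ?case by simp
qed simp

section \<open>Convergence of the scheme\<close>

lemma heat_scheme_error:
  assumes L: "L > 0" and g: "sobolev_family L 6 g"
    and bdry: "g 1 0 = 0" "g 1 L = 0" "g 3 0 = 0" "g 3 L = 0"
    and J: "J \<ge> 2" and dt: "0 < dt" "dt / (grid_dx L J)\<^sup>2 \<le> 1/2"
  shows "l2_norm J (\<lambda>j. grid_proj L J (heat_sol L (g 0) (real n * dt)) j
      - neumann_iter (dt / (grid_dx L J)\<^sup>2) J n (grid_proj L J (g 0)) j)
    \<le> 300 / L * (grid_dx L J * (\<Sum>p. \<bar>coeff L (g 0) (Suc p)\<bar> * real (Suc p) ^ 4))"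
proof -
  define h r where "h = grid_dx L J" and "r = dt / (grid_dx L J)\<^sup>2"
  define \<alpha> where "\<alpha> = coeff L (g 0)"
  define ex where "ex p = exp (- ((real p)\<^sup>2 * pi\<^sup>2 * (real n * dt) / L\<^sup>2))" for p
  define c where "c p = grid_proj L J (cbasis L p)" for p
  have sm: "summable (\<lambda>p. \<bar>\<alpha> (Suc p)\<bar> * real (Suc p) ^ 4)"
    unfolding \<alpha>_def by (rule summable_coeff[OF L g bdry])
  have "summable (\<lambda>p. \<bar>\<alpha> (Suc p)\<bar>)"
  proof (rule summable_comparison_test'[OF sm, where N = 0])
    fix p
    have "\<bar>\<alpha> (Suc p)\<bar> * 1 \<le> \<bar>\<alpha> (Suc p)\<bar> * real (Suc p) ^ 4"
      by (intro mult_left_mono one_le_power) auto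
    then show "norm \<bar>\<alpha> (Suc p)\<bar> \<le> \<bar>\<alpha> (Suc p)\<bar> * real (Suc p) ^ 4" by simp
  qed
  then have sm0: "summable (\<lambda>p. \<bar>\<alpha> p\<bar>)" by (subst (asm) summable_Suc_iff)
  \<comment> \<open>The scheme acts on samples of the datum, so the expansion is needed pointwise at
    the grid points, including the ends.\<close>
  have u0: "(\<lambda>p. \<alpha> p * c p k) sums grid_proj L J (g 0) k" if "k < J" for k
  proof -
    have "real k * grid_dx L J \<in> {0..L}" by (rule grid_point_mem) fact+
    then show ?thesis
      unfolding c_def grid_proj_def \<alpha>_def using sm0
      by (intro cosine_series_sums L sobolev_family_continuous[OF g]) (auto simp: \<alpha>_def)
  qed
  have heat: "(\<lambda>p. \<alpha> p * ex p * c p k) sums grid_proj L J (heat_sol L (g 0) (real n * dt)) k" for k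
    unfolding c_def grid_proj_def heat_sol_def \<alpha>_def[symmetric] ex_def[symmetric]
  proof (rule summable_sums, rule summable_comparison_test'[OF summable_mult2[OF sm0, of 2], where N = 0])
    fix p
    have "\<bar>ex p\<bar> * \<bar>cbasis L p (real k * grid_dx L J)\<bar> \<le> 1 * 2"
      using dt by (intro mult_mono abs_cbasis_le) (auto simp: ex_def)
    then show "norm (\<alpha> p * ex p * cbasis L p (real k * grid_dx L J)) \<le> \<bar>\<alpha> p\<bar> * 2"
      by (simp add: abs_mult mult.assoc mult_left_mono)
  qed
  define b where "b p = 300 / L * (h * (\<bar>\<alpha> p\<bar> * real p ^ 4))" for p
  have smb: "summable b"
  proof -
    have "summable (\<lambda>p. b (Suc p))" unfolding b_def by (intro summable_mult sm)
    then show ?thesis by (subst (asm) summable_Suc_iff)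
  qed
  have "l2_norm J (\<lambda>j. grid_proj L J (heat_sol L (g 0) (real n * dt)) j - neumann_iter r J n (grid_proj L J (g 0)) j)
      \<le> suminf b"
  proof (rule l2_norm_suminf_le[OF _ _ smb])
    show "(\<lambda>p. \<alpha> p * (ex p * c p i - neumann_iter r J n (c p) i)) sums
        (grid_proj L J (heat_sol L (g 0) (real n * dt)) i - neumann_iter r J n (grid_proj L J (g 0)) i)" if "i < J" for i
      using sums_diff[OF heat neumann_iter_sums[where r = r and n = n, OF u0 that]]
      by (simp add: neumann_iter_scale right_diff_distrib mult.assoc)
    show "l2_norm J (\<lambda>i. \<alpha> p * (ex p * c p i - neumann_iter r J n (c p) i)) \<le> b p" for p
    proof (cases "p = 0")
      case True
      have "c p = (\<lambda>_. 1)" using True by (simp add: c_def grid_proj_def cbasis_def fun_eq_iff)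
      then show ?thesis using True by (simp add: neumann_iter_const ex_def b_def l2_norm_def)
    next
      case False
      then have "l2_norm J (\<lambda>i. ex p * c p i - neumann_iter r J n (c p) i) \<le> 300 / L * h * real p ^ 4"
        unfolding ex_def c_def r_def h_def by (intro mode_error L J dt) simp
      then have "\<bar>\<alpha> p\<bar> * l2_norm J (\<lambda>i. ex p * c p i - neumann_iter r J n (c p) i) \<le> \<bar>\<alpha> p\<bar> * (300 / L * h * real p ^ 4)"
        by (intro mult_left_mono) auto
      then show ?thesis unfolding l2_norm_scale by (simp add: b_def mult_ac)
    qed
  qed
  \<comment> \<open>The zero mode drops out because its weight 0^4 vanishes.\<close>
  also have "suminf b = (\<Sum>p. b (Suc p))"
    using suminf_split_head[OF smb] by (simp add: b_def)
  also have "\<dots> = 300 / L * (h * (\<Sum>p. \<bar>\<alpha> (Suc p)\<bar> * real (Suc p) ^ 4))"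
    unfolding b_def by (simp only: suminf_mult[OF summable_mult[OF sm]] suminf_mult[OF sm])
  finally show ?thesis unfolding r_def h_def \<alpha>_def .
qed

theorem theorem2p12:
  fixes L :: real
  assumes "L > 0"
  shows "\<exists>C>0. \<forall>(u0 :: real \<Rightarrow> real) (g :: nat \<Rightarrow> real \<Rightarrow> real) (J :: nat) (dt :: real)
            (v :: nat \<Rightarrow> nat \<Rightarrow> real) (n :: nat).
     sobolev_family L 6 g \<and> (\<forall>x\<in>{0..L}. u0 x = g 0 x) \<and>
     g 1 0 = 0 \<and> g 1 L = 0 \<and> g 3 0 = 0 \<and> g 3 L = 0 \<and> g 5 0 = 0 \<and> g 5 L = 0 \<and>
     J \<ge> 2 \<and> 0 < dt \<and> dt < 1 \<and> dt / (grid_dx L J)\<^sup>2 \<le> 1 / 2 \<and>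
     (\<forall>m. \<forall>i<J. v (Suc m) i = v m i + dt * (\<Sum>k<J. Pdelta L J i k * v m k)) \<and>
     n \<ge> 1
     \<longrightarrow>
     l2_norm J (\<lambda>j. grid_proj L J (heat_sol L u0 (real n * dt)) j - v n j)
       \<le> l2_norm J (\<lambda>j. grid_proj L J u0 j - v 0 j)
         + C * (grid_dx L J * (\<Sum>p. \<bar>coeff L u0 (Suc p)\<bar> * (real (Suc p)) ^ 4)
                + dt * H1_norm L (g 4) (g 5))"
proof (intro exI[of _ "300 / L"] conjI allI impI, goal_cases)
  case 1
  show ?case using assms by simp
next
  case (2 u0 g J dt v n)
  then have g: "sobolev_family L 6 g" and u0: "\<And>x. x \<in> {0..L} \<Longrightarrow> u0 x = g 0 x"
    and bdry: "g 1 0 = 0" "g 1 L = 0" "g 3 0 = 0" "g 3 L = 0"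
    and J: "J \<ge> 2" and dt: "0 < dt" "dt / (grid_dx L J)\<^sup>2 \<le> 1/2"
    and v: "\<And>m i. i < J \<Longrightarrow> v (Suc m) i = v m i + dt * (\<Sum>k<J. Pdelta L J i k * v m k)"
    by blast+
  define r where "r = dt / (grid_dx L J)\<^sup>2"
  have r: "0 \<le> r" "r \<le> 1/2" using dt by (auto simp: r_def)
  have coeff: "coeff L u0 = coeff L (g 0)"
    unfolding coeff_def fun_eq_iff
    by (intro allI arg_cong[where f = "\<lambda>i. 1 / L * i"] integral_cong) (simp add: u0)
  then have heat: "heat_sol L u0 = heat_sol L (g 0)" by (simp add: heat_sol_def fun_eq_iff)
  have proj: "grid_proj L J u0 k = grid_proj L J (g 0) k" if "k < J" for k
    using u0[OF grid_point_mem[OF assms J that]] by (simp add: grid_proj_def)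
  \<comment> \<open>\<open>?E\<close> is the error for exactly sampled initial data,
    \<open>?D\<close> the initial error propagated by the linear scheme.\<close>
  let ?E = "\<lambda>j. grid_proj L J (heat_sol L (g 0) (real n * dt)) j - neumann_iter r J n (grid_proj L J (g 0)) j"
  let ?D = "neumann_iter r J n (\<lambda>j. grid_proj L J u0 j - v 0 j)"
  have "l2_norm J (\<lambda>j. grid_proj L J (heat_sol L u0 (real n * dt)) j - v n j) = l2_norm J (\<lambda>j. ?E j + ?D j)"
    unfolding heat neumann_iter_diff
    by (intro l2_norm_cong)
      (simp add: r_def scheme_eq_neumann_iter[where v = v, OF J v] neumann_iter_cong[OF proj])
  also have "\<dots> \<le> l2_norm J ?E + l2_norm J ?D" by (rule l2_norm_triangle)
  also have "l2_norm J ?D \<le> l2_norm J (\<lambda>j. grid_proj L J u0 j - v 0 j)"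
    by (rule l2_norm_neumann_iter[OF r])
  also have "l2_norm J ?E \<le> 300 / L * (grid_dx L J * (\<Sum>p. \<bar>coeff L u0 (Suc p)\<bar> * real (Suc p) ^ 4))"
    unfolding r_def coeff by (rule heat_scheme_error[OF assms g bdry J dt])
  also have "\<dots> \<le> 300 / L * (grid_dx L J * (\<Sum>p. \<bar>coeff L u0 (Suc p)\<bar> * real (Suc p) ^ 4) + dt * H1_norm L (g 4) (g 5))"
  proof -
    \<comment> \<open>The case split gives the sign for every \<open>f\<close>: a non-integrable
      function has integral 0 by default.\<close>
    have "0 \<le> integral {0..L} (\<lambda>x. (f x)\<^sup>2)" for f :: "real \<Rightarrow> real"
      by (cases "(\<lambda>x. (f x)\<^sup>2) integrable_on {0..L}") (auto intro: integral_nonneg simp: not_integrable_integral)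
    then have "0 \<le> H1_norm L (g 4) (g 5)" by (simp add: H1_norm_def)
    then show ?thesis using assms dt by (intro mult_left_mono) auto
  qed
  finally show ?case by simp
qed

end
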